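(* Let $\Pi$ be an equivalence relation on $\mathbb{N}$ decided by a total recursive $\pi$, and suppose there is a total recursive function $\rho$ with $\rho(x) = 0$ if $|P(x)| = \infty$ and $\rho(x) = |P(x)|$ otherwise, where $P(x)$ is the block of $\Pi$ containing $x$. Then there is a recursive semi-normal permutation whose cycles are exactly the blocks of $\Pi$, and it can be constructed from $\pi$ and $\rho$.
   Context: Let $\delta:\mathbb{Z}\to\mathbb{N}$, $\delta(0)=0$, $\delta(k)=2k$ ($k>0$), $\delta(k)=-2k-1$ ($k<0$). A permutation $f$ of $\mathbb{N}$ is semi-normal if every infinite cycle with least element $a_0$ has $j\mapsto f^{\delta^{-1}(j)}(a_0)$ strictly increasing for all $j\ge0$, and every finite cycle of length $n$ with least element $a_0$ has $j\mapsto f^j(a_0)$ strictly increasing for $0\le j<n$. Cycles are orbits $\{f^k(x):k\in\mathbb{Z}\}$. *)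

theory Defs
  imports Complex_Main
begin

subsection \<open>Recursive functions, possibly relative to given functions\<close>

text \<open>
  Terms for the mu-recursive functions over \<open>Oracle 0\<close>, \<open>Oracle 1\<close>, \dots. A term has no fixed
  arity: \<open>run Fs e xs\<close> is the value of the \<open>length xs\<close>-ary partial function denoted by \<open>e\<close> when
  \<open>Oracle i\<close> stands for the \<open>i\<close>-th member of the list \<open>Fs\<close>; \<open>None\<close> means undefined (or that the
  number of arguments is wrong). With \<open>Fs = []\<close> this is ordinary recursiveness.
\<close>

datatype recterm =
    Zero
  | Succ
  | Proj nat
  | Oracle nat
  | Comp recterm "recterm list"
  | PrimRec recterm recterm
  | Mu recterm

fun run :: "(nat list \<Rightarrow> nat option) list \<Rightarrow> recterm \<Rightarrow> nat list \<Rightarrow> nat option" where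
  "run Fs Zero = (\<lambda>xs. Some 0)"
| "run Fs Succ = (\<lambda>xs. case xs of [x] \<Rightarrow> Some (Suc x) | _ \<Rightarrow> None)"
| "run Fs (Proj i) = (\<lambda>xs. if i < length xs then Some (xs ! i) else None)"
| "run Fs (Oracle i) = (\<lambda>xs. if i < length Fs then (Fs ! i) xs else None)"
| "run Fs (Comp h gs) = (\<lambda>xs. Option.bind (those (map (\<lambda>g. run Fs g xs) gs)) (run Fs h))"
| "run Fs (PrimRec g h) = (\<lambda>xs. case xs of [] \<Rightarrow> None
     | n # ys \<Rightarrow> rec_nat (run Fs g ys) (\<lambda>k r. Option.bind r (\<lambda>v. run Fs h (k # v # ys))) n)"
| "run Fs (Mu g) = (\<lambda>xs.
     if \<exists>n. run Fs g (n # xs) = Some 0 \<and> (\<forall>m<n. run Fs g (m # xs) \<noteq> None)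
     then Some (LEAST n. run Fs g (n # xs) = Some 0) else None)"

definition fun1 :: "(nat \<Rightarrow> nat) \<Rightarrow> nat list \<Rightarrow> nat option" where
  "fun1 f xs = (case xs of [x] \<Rightarrow> Some (f x) | _ \<Rightarrow> None)"

definition fun2 :: "(nat \<Rightarrow> nat \<Rightarrow> nat) \<Rightarrow> nat list \<Rightarrow> nat option" where
  "fun2 f xs = (case xs of [x, y] \<Rightarrow> Some (f x y) | _ \<Rightarrow> None)"

definition computes1 :: "(nat list \<Rightarrow> nat option) list \<Rightarrow> recterm \<Rightarrow> (nat \<Rightarrow> nat) \<Rightarrow> bool" where
  "computes1 Fs e f \<longleftrightarrow> (\<forall>x. run Fs e [x] = Some (f x))"

definition computes2 :: "(nat list \<Rightarrow> nat option) list \<Rightarrow> recterm \<Rightarrow> (nat \<Rightarrow> nat \<Rightarrow> nat) \<Rightarrow> bool" where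
  "computes2 Fs e f \<longleftrightarrow> (\<forall>x y. run Fs e [x, y] = Some (f x y))"

definition total_recursive1 :: "(nat \<Rightarrow> nat) \<Rightarrow> bool" where
  "total_recursive1 f \<longleftrightarrow> (\<exists>e. computes1 [] e f)"

definition total_recursive2 :: "(nat \<Rightarrow> nat \<Rightarrow> nat) \<Rightarrow> bool" where
  "total_recursive2 f \<longleftrightarrow> (\<exists>e. computes2 [] e f)"

definition decides :: "(nat \<Rightarrow> nat \<Rightarrow> nat) \<Rightarrow> nat rel \<Rightarrow> bool" where
  "decides p R \<longleftrightarrow> (\<forall>x y. p x y = (if (x, y) \<in> R then 1 else 0))"


subsection \<open>Cycles and semi-normal permutations\<close>

definition zpow :: "('a \<Rightarrow> 'a) \<Rightarrow> int \<Rightarrow> 'a \<Rightarrow> 'a" where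
  "zpow f k = (if 0 \<le> k then f ^^ nat k else inv f ^^ nat (- k))"

definition cycle :: "('a \<Rightarrow> 'a) \<Rightarrow> 'a \<Rightarrow> 'a set" where
  "cycle f x = range (\<lambda>k::int. zpow f k x)"

definition cycles :: "('a \<Rightarrow> 'a) \<Rightarrow> 'a set set" where
  "cycles f = range (cycle f)"

definition delta :: "int \<Rightarrow> nat" where
  "delta k = (if k = 0 then 0 else if 0 < k then nat (2 * k) else nat (- 2 * k - 1))"

lemma bij_delta: "bij delta"
proof (rule bijI)
  show "inj delta"
  proof (rule injI)
    fix x y assume eq: "delta x = delta y"
    have int_delta: "int (delta k) = (if 0 \<le> k then 2 * k else - 2 * k - 1)" for k
      by (simp add: delta_def)
    from eq have "int (delta x) = int (delta y)"
      by simp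
    then show "x = y"
      unfolding int_delta by (simp split: if_splits; presburger)
  qed
  show "surj delta"
  proof (rule surjI)
    fix n :: nat
    show "delta (if even n then int n div 2 else - ((int n + 1) div 2)) = n"
      by (cases "even n") (auto simp: delta_def elim!: evenE oddE)
  qed
qed

definition semi_normal :: "(nat \<Rightarrow> nat) \<Rightarrow> bool" where
  "semi_normal f \<longleftrightarrow> bij f \<and>
     (\<forall>C \<in> cycles f. let a0 = (LEAST a. a \<in> C) in
        (infinite C \<longrightarrow> strict_mono (\<lambda>j::nat. zpow f (inv delta j) a0)) \<and>
        (finite C \<longrightarrow> strict_mono_on {0..<card C} (\<lambda>j. (f ^^ j) a0)))"

end

theory Submission
  imports Defs "HOL-Library.Infinite_Set"
begin

text \<open>
  List a block \<open>C\<close> increasingly as \<open>b 0 < b 1 < \<dots>\<close> and let the permutation shift a two-sided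
  enumeration of \<open>C\<close>: \<open>k \<mapsto> b (\<delta> k)\<close> if \<open>C\<close> is infinite and \<open>k \<mapsto> b (k mod n)\<close> if \<open>C\<close> has \<open>n\<close>
  elements. On indices this shift is an explicit arithmetical function of \<open>i\<close> and \<open>\<rho>(b i)\<close>,
  namely \<open>i \<mapsto> i + 2\<close> for even \<open>i\<close> and \<open>i \<mapsto> i \<ominus> 2\<close> for odd \<open>i\<close> if \<open>\<rho> = 0\<close>, and
  \<open>i \<mapsto> i + 1\<close> modulo \<open>\<rho>\<close> otherwise. The index of \<open>x\<close> is \<open>\<Sum>y<x. \<pi> x y\<close>, so the image of \<open>x\<close>
  is found by searching for the element of its block that has the required index.
\<close>

subsection \<open>Shifting a block\<close>

definition rank_in :: "nat set \<Rightarrow> nat \<Rightarrow> nat" where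
  "rank_in C x = card {y \<in> C. y < x}"

text \<open>The number \<open>n\<close> is the size of the block, with \<open>n = 0\<close> (as for \<open>card\<close>) for infinite blocks.
  The truncated subtraction sends the index \<open>1 = \<delta> (-1)\<close> to \<open>0 = \<delta> 0\<close>.\<close>

definition next_index :: "nat \<Rightarrow> nat \<Rightarrow> nat" where
  "next_index n i =
     (if n = 0 then if even i then i + 2 else i - 2 else if Suc i < n then Suc i else 0)"

text \<open>A least element, so that this is literally the value of an unbounded search; only one
  element of \<open>C\<close> has the required rank.\<close>

definition block_succ :: "nat set \<Rightarrow> nat \<Rightarrow> nat" where
  "block_succ C x = (LEAST y. y \<in> C \<and> rank_in C y = next_index (card C) (rank_in C x))"

definition walk_index :: "nat set \<Rightarrow> int \<Rightarrow> nat" where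
  "walk_index C k = (if infinite C then delta k else nat (k mod int (card C)))"

definition walk :: "nat set \<Rightarrow> int \<Rightarrow> nat" where
  "walk C k = enumerate C (walk_index C k)"

text \<open>Each assumption says that a position is valid, which lets finite and infinite sets share
  one set of facts.\<close>

lemma enumerate_less_iff:
  fixes C :: "nat set"
  assumes "infinite C \<or> i < card C" "infinite C \<or> j < card C"
  shows "enumerate C i < enumerate C j \<longleftrightarrow> i < j"
  using assms
  by (metis enumerate_mono_iff finite_enumerate_mono_iff)

lemma enumerate_eq_iff:
  fixes C :: "nat set"
  assumes "infinite C \<or> i < card C" "infinite C \<or> j < card C"
  shows "enumerate C i = enumerate C j \<longleftrightarrow> i = j"
  using enumerate_less_iff[OF assms] enumerate_less_iff[OF assms(2,1)]
  by (metis less_irrefl linorder_neqE_nat)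

lemma enumerate_mem:
  fixes C :: "nat set"
  assumes "infinite C \<or> i < card C"
  shows "enumerate C i \<in> C"
  using assms by (metis enumerate_in_set finite_enumerate_in_set)

lemma enumerate_cover:
  fixes C :: "nat set"
  assumes "x \<in> C"
  obtains i where "infinite C \<or> i < card C" "x = enumerate C i"
  using assms by (metis enumerate_Ex finite_enumerate_Ex)

lemma rank_in_enumerate:
  assumes "infinite C \<or> i < card C"
  shows "rank_in C (enumerate C i) = i"
proof -
  have "{y \<in> C. y < enumerate C i} = enumerate C ` {..<i}"
  proof (intro equalityI subsetI)
    fix y assume "y \<in> {y \<in> C. y < enumerate C i}"
    moreover from this obtain j where "infinite C \<or> j < card C" "y = enumerate C j"
      by (auto elim: enumerate_cover)
    ultimately show "y \<in> enumerate C ` {..<i}"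
      using enumerate_less_iff[OF _ assms] by auto
  next
    fix y assume "y \<in> enumerate C ` {..<i}"
    then obtain j where j: "j < i" "y = enumerate C j"
      by auto
    then have "infinite C \<or> j < card C"
      using assms by auto
    then show "y \<in> {y \<in> C. y < enumerate C i}"
      using j enumerate_less_iff[OF _ assms] enumerate_mem by auto
  qed
  moreover have "inj_on (enumerate C) {..<i}"
    using assms by (intro inj_onI) (auto simp: enumerate_eq_iff)
  ultimately show ?thesis
    by (simp add: rank_in_def card_image)
qed

section \<open>The two-sided walk through a block\<close>

lemma walk_index_valid:
  assumes "C \<noteq> {}"
  shows "infinite C \<or> walk_index C k < card C"
  using assms by (auto simp: walk_index_def nat_less_iff card_gt_0_iff)

text \<open>For infinite \<open>C\<close>, \<open>delta\<close> puts the negative integers on the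
  odd indices: as \<open>k\<close> grows, these fall by 2 down to 1, then comes 0, and the even
  indices rise by 2. For finite \<open>C\<close> the only wrap is at index
  \<open>card C - 1\<close>.\<close>

lemma walk_index_add_1:
  assumes "C \<noteq> {}"
  shows "next_index (card C) (walk_index C k) = walk_index C (k + 1)"
proof (cases "finite C")
  case True
  define n where "n = int (card C)"
  have n: "0 < n"
    using True assms by (simp add: n_def card_gt_0_iff)
  have m: "0 \<le> k mod n" "k mod n < n"
    using n by simp_all
  have "(k + 1) mod n = (if k mod n + 1 < n then k mod n + 1 else 0)"
  proof -
    have "(k + 1) mod n = (k mod n + 1) mod n"
      by (simp add: mod_add_left_eq)
    also have "\<dots> = (if k mod n + 1 < n then k mod n + 1 else 0)"
      using m by (cases "k mod n + 1 = n") auto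
    finally show ?thesis .
  qed
  moreover have "next_index (card C) (walk_index C k) =
      (if Suc (nat (k mod n)) < card C then Suc (nat (k mod n)) else 0)"
    using True assms by (simp add: next_index_def walk_index_def n_def)
  moreover have "walk_index C (k + 1) = nat ((k + 1) mod n)"
    using True by (simp add: walk_index_def n_def)
  moreover have "Suc (nat (k mod n)) < card C \<longleftrightarrow> k mod n + 1 < n"
    using m(1) unfolding n_def by linarith
  ultimately show ?thesis
    using m(1) by (simp add: nat_add_distrib)
next
  case False
  consider "0 \<le> k" | "k = -1" | "k < -1"
    by linarith
  then show ?thesis
  proof cases
    case 1
    then have "delta k = 2 * nat k" "delta (k + 1) = 2 * nat k + 2"
      by (auto simp: delta_def)
    then show ?thesis
      using False by (simp add: next_index_def walk_index_def)
  next
    case 2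
    then show ?thesis
      using False by (simp add: next_index_def walk_index_def delta_def)
  next
    case 3
    \<comment> \<open>The distance of \<open>k\<close> below -2; hence \<open>delta k\<close> is at
      least 3 and the truncated subtraction is exact.\<close>
    define m where "m = nat (- k - 2)"
    have "k = - int m - 2"
      using 3 by (simp add: m_def)
    then have "delta k = 2 * m + 3" "delta (k + 1) = 2 * m + 1"
      by (auto simp: delta_def)
    then show ?thesis
      using False by (simp add: next_index_def walk_index_def)
  qed
qed

text \<open>Yields injectivity of the shift. For finite \<open>C\<close> the walk is periodic, so
  equality means congruence modulo \<open>card C\<close>, which survives adding 1.\<close>

lemma walk_eq_add_1_iff:
  assumes "C \<noteq> {}"
  shows "walk C (k + 1) = walk C (m + 1) \<longleftrightarrow> walk C k = walk C m"
proof -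
  have "walk_index C (k + 1) = walk_index C (m + 1) \<longleftrightarrow> walk_index C k = walk_index C m"
  proof (cases "finite C")
    case True
    then have "0 < int (card C)"
      using assms by (simp add: card_gt_0_iff)
    then show ?thesis
      using True by (simp add: walk_index_def eq_nat_nat_iff mod_eq_dvd_iff)
  next
    case False
    then show ?thesis
      using bij_delta by (simp add: walk_index_def bij_is_inj inj_eq)
  qed
  then show ?thesis
    using walk_index_valid[OF assms] by (simp add: walk_def enumerate_eq_iff)
qed

lemma range_walk:
  assumes "C \<noteq> {}"
  shows "range (walk C) = C"
proof (intro equalityI subsetI)
  fix x assume "x \<in> range (walk C)"
  then show "x \<in> C"
    using walk_index_valid[OF assms] by (auto simp: walk_def enumerate_mem)
next
  fix x assume "x \<in> C"
  then obtain i where i: "infinite C \<or> i < card C" "x = enumerate C i"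
    by (rule enumerate_cover)
  have "walk_index C (if infinite C then inv delta i else int i) = i"
    using i bij_delta by (auto simp: walk_index_def bij_is_surj surj_f_inv_f)
  then have "x = walk C (if infinite C then inv delta i else int i)"
    using i by (simp add: walk_def)
  then show "x \<in> range (walk C)"
    by blast
qed

text \<open>The rank of a point of the walk is its index, and a rank determines the element. The
  first two claims also show that the search succeeds.\<close>

lemma block_succ_walk:
  assumes "C \<noteq> {}"
  shows "walk C (k + 1) \<in> C"
    and "rank_in C (walk C (k + 1)) = next_index (card C) (rank_in C (walk C k))"
    and "block_succ C (walk C k) = walk C (k + 1)"
proof -
  have rank: "rank_in C (walk C m) = walk_index C m" for m
    using walk_index_valid[OF assms] by (simp add: walk_def rank_in_enumerate)
  show mem: "walk C (k + 1) \<in> C"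
    using range_walk[OF assms] by blast
  show rank_next: "rank_in C (walk C (k + 1)) = next_index (card C) (rank_in C (walk C k))"
    by (simp add: rank walk_index_add_1[OF assms])
  have unique: "y = walk C (k + 1)"
    if "y \<in> C" "rank_in C y = next_index (card C) (rank_in C (walk C k))" for y
  proof -
    from that(1) obtain i where "infinite C \<or> i < card C" "y = enumerate C i"
      by (rule enumerate_cover)
    moreover from this have "i = walk_index C (k + 1)"
      using that(2) by (simp add: rank_in_enumerate rank walk_index_add_1[OF assms])
    ultimately show ?thesis
      by (simp add: walk_def)
  qed
  show "block_succ C (walk C k) = walk C (k + 1)"
    unfolding block_succ_def using mem rank_next by (rule LeastI2[OF conjI]) (blast intro: unique)
qed


subsection \<open>Shifting all blocks of a partition\<close>

text \<open>\<open>g\<close> may repeat values, so periodic orbits are covered too.\<close>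

lemma zpow_orbit:
  fixes g :: "int \<Rightarrow> 'a"
  assumes "bij f" and shift: "\<And>k. f (g k) = g (k + 1)"
  shows "zpow f k (g m) = g (m + k)"
proof -
  have fwd: "(f ^^ n) (g m) = g (m + int n)" for n
    by (induction n) (simp_all add: shift algebra_simps)
  have "inv f (g k) = g (k - 1)" for k
    using shift[of "k - 1"] assms(1) by (metis bij_inv_eq_iff diff_add_cancel)
  then have "(inv f ^^ n) (g m) = g (m - int n)" for n
    by (induction n) (simp_all add: algebra_simps)
  then show ?thesis
    by (simp add: zpow_def fwd)
qed

lemma cycle_orbit:
  fixes g :: "int \<Rightarrow> 'a"
  assumes "bij f" "\<And>k. f (g k) = g (k + 1)"
  shows "cycle f (g m) = range g"
proof -
  have "cycle f (g m) = range (\<lambda>k. g (m + k))"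
    by (simp add: cycle_def zpow_orbit[where g = g, OF assms])
  also have "\<dots> = range g"
  proof (intro equalityI subsetI)
    fix x assume "x \<in> range g"
    then obtain k where "x = g (m + (k - m))"
      by auto
    then show "x \<in> range (\<lambda>k. g (m + k))"
      by blast
  qed blast
  finally show ?thesis .
qed

section \<open>The permutation of an equivalence relation\<close>

context
  fixes R :: "nat rel" and f :: "nat \<Rightarrow> nat"
  assumes equiv: "equiv UNIV R"
  defines "f \<equiv> \<lambda>x. block_succ (R `` {x}) x"
begin

lemma block_eq: "y \<in> R `` {x} \<Longrightarrow> R `` {y} = R `` {x}"
  using equiv_class_eq[OF equiv, of x y] by simp

lemma self_in_block: "x \<in> R `` {x}"
  by (rule equiv_class_self[OF equiv UNIV_I])

lemma block_ne: "R `` {x} \<noteq> {}"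
  using self_in_block by blast

lemma walk_in_block: "walk (R `` {x}) k \<in> R `` {x}"
  using range_walk[OF block_ne] by blast

lemma walk_cover: obtains k where "walk (R `` {x}) k = x"
proof -
  have "x \<in> range (walk (R `` {x}))"
    unfolding range_walk[OF block_ne] by (rule self_in_block)
  then show thesis
    using that by (metis rangeE)
qed

text \<open>The walk never leaves the block of \<open>x\<close>, so \<open>f\<close> uses the same
  block at each of its points.\<close>

lemma f_walk: "f (walk (R `` {x}) k) = walk (R `` {x}) (k + 1)"
  unfolding f_def block_eq[OF walk_in_block] by (rule block_succ_walk(3)[OF block_ne])

lemma f_in_block: "f x \<in> R `` {x}"
proof -
  obtain k where "walk (R `` {x}) k = x"
    by (rule walk_cover)
  then have "f x = walk (R `` {x}) (k + 1)"
    using f_walk[of x k] by simp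
  then show ?thesis
    by (simp only: walk_in_block)
qed

lemma bij_f: "bij f"
proof (rule bijI)
  show "inj f"
  proof (rule injI)
    fix x y assume eq: "f x = f y"
    \<comment> \<open>\<open>f\<close> preserves blocks, so a common image puts \<open>x\<close> and
      \<open>y\<close> on the same walk.\<close>
    have block: "R `` {y} = R `` {x}"
      using block_eq[OF f_in_block[of x]] block_eq[OF f_in_block[of y]] eq by simp
    obtain k where k: "walk (R `` {x}) k = x"
      by (rule walk_cover)
    obtain m where m: "walk (R `` {x}) m = y"
      using walk_cover[of y] unfolding block .
    have "walk (R `` {x}) (k + 1) = walk (R `` {x}) (m + 1)"
      using eq f_walk[of x k] f_walk[of x m] by (simp add: k m)
    then show "x = y"
      using walk_eq_add_1_iff[OF block_ne] k m by metis
  qed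
  show "surj f"
    unfolding surj_def
  proof
    fix y
    obtain k where "walk (R `` {y}) k = y"
      by (rule walk_cover)
    then have "y = f (walk (R `` {y}) (k - 1))"
      by (simp add: f_walk)
    then show "\<exists>x. y = f x"
      by blast
  qed
qed

lemma cycle_f: "cycle f x = R `` {x}"
proof -
  obtain k where "walk (R `` {x}) k = x"
    by (rule walk_cover)
  then show ?thesis
    using cycle_orbit[where g = "walk (R `` {x})", OF bij_f f_walk, of k]
    by (simp add: range_walk[OF block_ne])
qed

lemma cycles_f: "cycles f = UNIV // R"
  by (auto simp: cycles_def cycle_f quotient_def)

text \<open>In both cases the \<open>j\<close>-th term is \<open>enumerate C j\<close>:
  \<open>delta\<close> cancels \<open>inv delta\<close> if \<open>C\<close> is infinite, and
  otherwise \<open>j < card C\<close> is its own residue.\<close>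

lemma semi_normal_f: "semi_normal f"
  unfolding semi_normal_def
proof (intro conjI ballI bij_f)
  fix C assume "C \<in> cycles f"
  then obtain x where C: "C = R `` {x}"
    by (auto simp: cycles_def cycle_f)
  have zp: "zpow f k (walk C 0) = walk C k" for k
    using zpow_orbit[where g = "walk C", OF bij_f, of k 0] f_walk[of x] by (simp add: C)
  have a0: "(LEAST a. a \<in> C) = walk C 0"
    by (simp add: walk_def walk_index_def delta_def enumerate_0)
  have "strict_mono (\<lambda>j. zpow f (inv delta j) (walk C 0))" if "infinite C"
    unfolding zp using that bij_delta
    by (simp add: walk_def walk_index_def bij_is_surj surj_f_inv_f strict_mono_enumerate)
  moreover have "strict_mono_on {0..<card C} (\<lambda>j. (f ^^ j) (walk C 0))" if "finite C"
  proof -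
    have "(f ^^ j) (walk C 0) = enumerate C j" if "j < card C" for j
      using zp[of "int j"] that \<open>finite C\<close> by (simp add: zpow_def walk_def walk_index_def)
    then show ?thesis
      using that by (auto intro!: strict_mono_onI finite_enumerate_mono)
  qed
  ultimately show "let a0 = LEAST a. a \<in> C in
      (infinite C \<longrightarrow> strict_mono (\<lambda>j. zpow f (inv delta j) a0)) \<and>
      (finite C \<longrightarrow> strict_mono_on {0..<card C} (\<lambda>j. (f ^^ j) a0))"
    by (simp add: a0)
qed

end


subsection \<open>Computing the shift\<close>

definition add_term :: recterm where
  "add_term = PrimRec (Proj 0) (Comp Succ [Proj 1])"

definition pred_term :: recterm where
  "pred_term = PrimRec Zero (Proj 0)"

text \<open>Primitive recursion runs over the first argument, so this subtracts the first argument from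
  the second.\<close>

definition monus_term :: recterm where
  "monus_term = PrimRec (Proj 0) (Comp pred_term [Proj 1])"

text \<open>Each step replaces the previous value \<open>v\<close> by \<open>1 - v\<close>.\<close>

definition parity_term :: recterm where
  "parity_term = PrimRec Zero (Comp monus_term [Proj 1, Comp Succ [Zero]])"

text \<open>On arguments \<open>n, a, b\<close> the step sees \<open>k, v, a, b\<close>, so
  \<open>Proj 3\<close> gives \<open>b\<close> as soon as \<open>n > 0\<close>.\<close>

definition if_zero_term :: recterm where
  "if_zero_term = PrimRec (Proj 0) (Proj 3)"

definition dist_term :: recterm where
  "dist_term = Comp add_term [monus_term, Comp monus_term [Proj 1, Proj 0]]"

text \<open>\<open>Suc i < n\<close> holds iff \<open>n - Suc i\<close> is nonzero, so the wrap to 0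
  sits in the zero branch.\<close>

definition next_index_term :: recterm where
  "next_index_term = Comp if_zero_term [Proj 0,
     Comp if_zero_term [Comp parity_term [Proj 1],
       Comp Succ [Comp Succ [Proj 1]],
       Comp pred_term [Comp pred_term [Proj 1]]],
     Comp if_zero_term [Comp monus_term [Comp Succ [Proj 1], Proj 0],
       Zero,
       Comp Succ [Proj 1]]]"

text \<open>The recursion runs over the bound of the sum with \<open>x\<close> fixed; only then are
  both set to \<open>x\<close>.\<close>

definition rank_term :: "recterm \<Rightarrow> recterm" where
  "rank_term P =
     Comp (PrimRec Zero (Comp add_term [Proj 1, Comp P [Proj 2, Proj 0]])) [Proj 0, Proj 0]"

text \<open>The term under \<open>Mu\<close> takes the candidate \<open>y\<close> first and then the argument \<open>x\<close>.\<close>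

definition block_succ_term :: "recterm \<Rightarrow> recterm \<Rightarrow> recterm" where
  "block_succ_term P Q = Mu (Comp add_term [
     Comp monus_term [Comp P [Proj 1, Proj 0], Comp Succ [Zero]],
     Comp dist_term [Comp (rank_term P) [Proj 0],
       Comp next_index_term [Comp Q [Proj 1], Comp (rank_term P) [Proj 1]]]])"

section \<open>Correctness of the terms\<close>

lemma run_add_term: "run Fs add_term [m, n] = Some (m + n)"
  unfolding add_term_def by (induction m) simp_all

lemma run_pred_term: "run Fs pred_term [n] = Some (n - 1)"
  unfolding pred_term_def by (induction n) simp_all

lemma run_monus_term: "run Fs monus_term [m, n] = Some (n - m)"
  unfolding monus_term_def by (induction m) (simp_all add: run_pred_term)

lemma run_parity_term: "run Fs parity_term [n] = Some (n mod 2)"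
  unfolding parity_term_def by (induction n) (simp_all add: run_monus_term, presburger)

lemma run_if_zero_term: "run Fs if_zero_term [n, a, b] = Some (if n = 0 then a else b)"
  unfolding if_zero_term_def by (induction n) simp_all

lemma run_dist_term: "run Fs dist_term [m, n] = Some ((n - m) + (m - n))"
  unfolding dist_term_def by (simp add: run_add_term run_monus_term)

lemma run_next_index_term: "run Fs next_index_term [n, i] = Some (next_index n i)"
  unfolding next_index_term_def
  by (auto simp: run_if_zero_term run_parity_term run_monus_term run_pred_term next_index_def
      even_iff_mod_2_eq_zero)

lemma run_rank_term:
  assumes "computes2 Fs P p" "decides p R"
  shows "run Fs (rank_term P) [x] = Some (rank_in (R `` {x}) x)"
proof -
  have "run Fs (PrimRec Zero (Comp add_term [Proj 1, Comp P [Proj 2, Proj 0]])) [n, x] =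
      Some (\<Sum>y<n. p x y)" for n
    using assms(1) by (induction n) (simp_all add: run_add_term computes2_def)
  moreover have "(\<Sum>y<x. p x y) = rank_in (R `` {x}) x"
  proof -
    have "(\<Sum>y<x. p x y) = card ({..<x} \<inter> {y. (x, y) \<in> R})"
      using assms(2) by (simp add: decides_def sum.If_cases)
    also have "{..<x} \<inter> {y. (x, y) \<in> R} = {y \<in> R `` {x}. y < x}"
      by auto
    finally show ?thesis
      by (simp add: rank_in_def)
  qed
  ultimately show ?thesis
    by (simp add: rank_term_def)
qed

text \<open>Arbitrary \<open>Fs\<close>, \<open>P\<close> and \<open>Q\<close> let this serve for
  programs and for oracles alike. The search ends because the next point of the walk passes the
  test.\<close>

lemma computes1_block_succ_term:
  assumes "equiv UNIV R" "decides p R" and r: "\<And>x. r x = card (R `` {x})"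
    and P: "computes2 Fs P p" and Q: "computes1 Fs Q r"
  shows "computes1 Fs (block_succ_term P Q) (\<lambda>x. block_succ (R `` {x}) x)"
  unfolding computes1_def
proof
  fix x
  let ?C = "R `` {x}"
  let ?ok = "\<lambda>y. y \<in> ?C \<and> rank_in ?C y = next_index (card ?C) (rank_in ?C x)"
  obtain test where test: "block_succ_term P Q = Mu test"
    and run_test: "\<And>y. run Fs test [y, x] =
      Some ((1 - p x y) + ((next_index (r x) (rank_in ?C x) - rank_in (R `` {y}) y)
        + (rank_in (R `` {y}) y - next_index (r x) (rank_in ?C x))))"
    using P Q
    by (auto simp: block_succ_term_def run_add_term run_monus_term run_dist_term
        run_next_index_term run_rank_term[OF P assms(2)] computes1_def computes2_def)
  \<comment> \<open>The sum vanishes iff all summands do. The test ranks \<open>y\<close> in its own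
    block, which is that of \<open>x\<close> once \<open>p x y = 1\<close>.\<close>
  have zero: "run Fs test [y, x] = Some 0 \<longleftrightarrow> ?ok y" for y
    using assms(2) block_eq[OF assms(1), of y x] by (auto simp: run_test r decides_def)
  obtain k where "walk ?C k = x"
    by (rule walk_cover[OF assms(1)])
  then have "?ok (walk ?C (k + 1))"
    using block_succ_walk(1,2)[OF block_ne[OF assms(1)], of x k] by simp
  then have "\<exists>y. run Fs test [y, x] = Some 0"
    unfolding zero by blast
  \<comment> \<open>The test is defined at every candidate, so one zero makes \<open>Mu\<close>
    defined.\<close>
  then have "run Fs (Mu test) [x] = Some (LEAST y. run Fs test [y, x] = Some 0)"
    by (auto simp: run_test)
  then show "run Fs (block_succ_term P Q) [x] = Some (block_succ ?C x)"
    unfolding zero test block_succ_def .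
qed

text \<open>Choosing \<open>e\<close> before \<open>R\<close>, \<open>p\<close> and \<open>r\<close>
  expresses uniformity: it reaches \<open>p\<close> and \<open>r\<close> only as oracles.\<close>

theorem theorem3p21:
  "\<exists>e :: recterm. \<forall>(R :: nat rel) (p :: nat \<Rightarrow> nat \<Rightarrow> nat) (r :: nat \<Rightarrow> nat).
     equiv UNIV R \<longrightarrow>
     total_recursive2 p \<longrightarrow> decides p R \<longrightarrow>
     total_recursive1 r \<longrightarrow>
     (\<forall>x. r x = (if infinite (R `` {x}) then 0 else card (R `` {x}))) \<longrightarrow>
     (\<exists>f :: nat \<Rightarrow> nat. total_recursive1 f \<and> semi_normal f \<and> cycles f = UNIV // R \<and>
        computes1 [fun2 p, fun1 r] e f)"
proof (intro exI[of _ "block_succ_term (Oracle 0) (Oracle 1)"] allI impI)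
  fix R :: "nat rel" and p :: "nat \<Rightarrow> nat \<Rightarrow> nat" and r :: "nat \<Rightarrow> nat"
  assume R: "equiv UNIV R" and p: "total_recursive2 p" "decides p R" and r: "total_recursive1 r"
    and card: "\<forall>x. r x = (if infinite (R `` {x}) then 0 else card (R `` {x}))"
  let ?f = "\<lambda>x. block_succ (R `` {x}) x"
  \<comment> \<open>\<open>card\<close> is 0 on infinite sets, so both cases agree with it.\<close>
  have "r x = card (R `` {x})" for x
    using card by simp
  note computes = computes1_block_succ_term[OF R p(2) this]
  obtain P Q where "computes2 [] P p" "computes1 [] Q r"
    using p(1) r by (auto simp: total_recursive1_def total_recursive2_def)
  then have "total_recursive1 ?f"
    using computes by (auto simp: total_recursive1_def)
  moreover have "computes1 [fun2 p, fun1 r] (block_succ_term (Oracle 0) (Oracle 1)) ?f"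
    by (rule computes) (simp_all add: computes1_def computes2_def fun1_def fun2_def)
  ultimately show "\<exists>f. total_recursive1 f \<and> semi_normal f \<and> cycles f = UNIV // R \<and>
      computes1 [fun2 p, fun1 r] (block_succ_term (Oracle 0) (Oracle 1)) f"
    using semi_normal_f[OF R] cycles_f[OF R] by blast
qed

end
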